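(* Let $X$ be a compact metric space with $\mathrm{mst}$-spectrum $\sigma(X)=\{\sigma_1,\sigma_2,\ldots\}$. Then for every $k\in\mathbb{N}$ with $k+1\le \#X$ and every real $\lambda\ge \operatorname{diam}X+\sigma_k$ we have $$2d_{GH}(\lambda\Delta_{k+1},X)=\lambda-\sigma_k .$$
   Context: Here $\mathbb{N}=\{1,2,\ldots\}$, $\#X$ is the cardinality of $X$, $|xy|$ is the distance between points $x,y$, and $d_{GH}$ is the Gromov--Hausdorff distance. For $\lambda>0$ and $m\in\mathbb{N}$, $\lambda\Delta_m$ denotes the $m$-point metric space (simplex) all of whose nonzero distances equal $\lambda$. For nonempty $A,B\subset X$ put $|AB|=\inf\{|ab|:a\in A,\,b\in B\}$. $\mathcal{D}_k(X)$ is the family of all partitions of $X$ into $k$ nonempty subsets. For $D=\{X_1,\ldots,X_k\}\in\mathcal{D}_k(X)$ with $k\ge 2$ put $\alpha(D)=\min\{|X_iX_j|:i\ne j\}$. For $k\in\mathbb{N}$ put $\sigma_k=\sup\{\alpha(D):D\in\mathcal{D}_{k+1}(X)\}$ if $\mathcal{D}_{k+1}(X)\neq\emptyset$, and $\sigma_k=0$ otherwise; $\sigma(X)=\{\sigma_1,\sigma_2,\ldots\}$ is called the $\mathrm{mst}$-spectrum of $X$. *)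

theory Defs
  imports "HOL-Analysis.Analysis"
begin

definition isometric_embedding :: "'a metric \<Rightarrow> 'b metric \<Rightarrow> ('a \<Rightarrow> 'b) \<Rightarrow> bool" where
  "isometric_embedding X Z f \<longleftrightarrow>
     f \<in> mspace X \<rightarrow> mspace Z \<and>
     (\<forall>x\<in>mspace X. \<forall>y\<in>mspace X. mdist Z (f x) (f y) = mdist X x y)"

text \<open>The infimum of all \<open>r > 0\<close> such that each set lies in the open \<open>r\<close>-neighbourhood of the
  other. It is taken in the extended reals, so it is \<open>\<infinity>\<close> if there is no such \<open>r\<close>.\<close>

definition hausdorff_distance :: "'a metric \<Rightarrow> 'a set \<Rightarrow> 'a set \<Rightarrow> ereal" where
  "hausdorff_distance Z A B =
     Inf {ereal r | r. 0 < r \<and> (\<forall>a\<in>A. \<exists>b\<in>B. mdist Z a b < r) \<and> (\<forall>b\<in>B. \<exists>a\<in>A. mdist Z a b < r)}"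

text \<open>The infimum of the Hausdorff distances of isometric copies of \<open>X\<close> and \<open>Y\<close> in a common
  metric space \<open>Z\<close>. Only the union of the two copies matters, and it has at most as many points as
  the disjoint union of \<open>X\<close> and \<open>Y\<close>; hence it is no restriction that the points of \<open>Z\<close> are taken
  from the type \<open>'a + 'b\<close>.\<close>

definition gromov_hausdorff :: "'a metric \<Rightarrow> 'b metric \<Rightarrow> ereal" where
  "gromov_hausdorff X Y =
     Inf {hausdorff_distance Z (f ` mspace X) (g ` mspace Y) | (Z :: ('a + 'b) metric) f g.
            isometric_embedding X Z f \<and> isometric_embedding Y Z g}"

text \<open>Meaningful for \<open>l > 0\<close> only: otherwise the pair below is in general not a metric space.\<close>

definition simplex_metric :: "real \<Rightarrow> nat \<Rightarrow> nat metric" where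
  "simplex_metric l m = metric ({..<m}, \<lambda>i j. if i = j then 0 else l)"

lemma
  assumes "0 < l"
  shows mspace_simplex_metric: "mspace (simplex_metric l m) = {..<m}"
    and mdist_simplex_metric: "mdist (simplex_metric l m) = (\<lambda>i j. if i = j then 0 else l)"
proof -
  have "Metric_space {..<m} (\<lambda>i j. if i = j then 0 else l)"
    using assms by unfold_locales auto
  then show "mspace (simplex_metric l m) = {..<m}"
    and "mdist (simplex_metric l m) = (\<lambda>i j. if i = j then 0 else l)"
    by (simp_all add: simplex_metric_def Metric_space.mspace_metric Metric_space.mdist_metric)
qed

text \<open>The library's \<^const>\<open>diameter\<close> and \<^const>\<open>setdist\<close> are tied to the class
  \<^class>\<open>metric_space\<close>; the following two are their counterparts for \<^typ>\<open>'a metric\<close>.\<close>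

definition mdiameter :: "'a metric \<Rightarrow> real" where
  "mdiameter X = (if mspace X = {} then 0 else SUP (x, y)\<in>mspace X \<times> mspace X. mdist X x y)"

definition msetdist :: "'a metric \<Rightarrow> 'a set \<Rightarrow> 'a set \<Rightarrow> real" where
  "msetdist X A B = Inf {mdist X a b | a b. a \<in> A \<and> b \<in> B}"

definition set_partitions :: "'a metric \<Rightarrow> nat \<Rightarrow> 'a set set set" where
  "set_partitions X k = {D. partition_on (mspace X) D \<and> finite D \<and> card D = k}"

definition partition_gap :: "'a metric \<Rightarrow> 'a set set \<Rightarrow> real" where
  "partition_gap X D = Min {msetdist X A B | A B. A \<in> D \<and> B \<in> D \<and> A \<noteq> B}"

text \<open>The \<open>mst\<close>-spectrum as the sequence of the \<open>\<sigma>\<^sub>k\<close>, for \<open>k \<ge> 1\<close>. The supremum is a genuine one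
  whenever \<open>X\<close> is bounded.\<close>

definition mst_spectrum :: "'a metric \<Rightarrow> nat \<Rightarrow> real" where
  "mst_spectrum X k =
     (if set_partitions X (k + 1) \<noteq> {} then SUP D\<in>set_partitions X (k + 1). partition_gap X D
      else 0)"

end

theory Submission
  imports Defs
begin

text \<open>
  Let \<open>m = k + 1\<close>. Partitions of \<open>X\<close> into \<open>m\<close> classes correspond to metrics that bring \<open>X\<close> and the
  simplex \<open>\<lambda>\<Delta>\<^sub>m\<close> close to each other: a class consists of the points that are close to one vertex.

  Given \<open>D\<close> with gap \<open>a\<close>, put the vertex of a class at distance \<open>(\<lambda> - a) / 2\<close> from the points of
  that class and at distance \<open>(\<lambda> + a) / 2\<close> from all other points. The triangle inequality holds
  because distances in \<open>X\<close> are at most \<open>\<lambda> - a\<close>, and those between different classes are at least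
  \<open>a\<close>. The first bound is where \<open>\<lambda> \<ge> diam X + \<sigma>\<^sub>k\<close> enters. Hence twice the Gromov--Hausdorff
  distance is at most \<open>\<lambda> - a\<close>, and the supremum over \<open>D\<close> gives the upper bound \<open>\<lambda> - \<sigma>\<^sub>k\<close>
  (lemmas \<open>Metric_space_glued_dist\<close> and \<open>gromov_hausdorff_simplex_le\<close>).

  Conversely, suppose that the copies of \<open>\<lambda>\<Delta>\<^sub>m\<close> and \<open>X\<close> lie within distance \<open>r\<close> of each other in
  some space, where \<open>2 r \<le> \<lambda>\<close>. Two vertices are \<open>\<lambda>\<close> apart, so no point of \<open>X\<close> is closer than \<open>r\<close>
  to both, and points close to different vertices have distance at least \<open>\<lambda> - 2 r\<close>. So \<open>X\<close>
  splits into \<open>m\<close> classes with gap at least \<open>\<lambda> - 2 r\<close>, which gives \<open>\<lambda> - 2 r \<le> \<sigma>\<^sub>k\<close>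
  (lemma \<open>gromov_hausdorff_simplex_ge\<close>).

  If \<open>2 r > \<lambda>\<close>, then \<open>\<lambda> - 2 r \<le> \<sigma>\<^sub>k\<close> holds because \<open>\<sigma>\<^sub>k \<ge> 0\<close>.

  Compactness enters through boundedness: it makes the suprema in the definitions of the diameter
  and of \<open>\<sigma>\<^sub>k\<close> genuine.
\<close>

section \<open>Diameter and gaps of partitions\<close>

abbreviation mbounded_space :: "'a metric \<Rightarrow> bool" where
  "mbounded_space X \<equiv> bdd_above ((\<lambda>(x, y). mdist X x y) ` (mspace X \<times> mspace X))"

lemma compact_imp_mbounded_space:
  assumes "compact_space (mtopology_of X)"
  shows "mbounded_space X"
proof -
  interpret Metric_space "mspace X" "mdist X" by simp
  have "compactin mtopology (mspace X)"
    using assms by (simp add: mtopology_of_def compact_space_def)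
  then have "mbounded (mspace X)" by (rule compactin_imp_mbounded)
  then show ?thesis
    unfolding mbounded_alt bdd_above_def by fastforce
qed

lemma mdist_le_mdiameter:
  assumes "mbounded_space X" "x \<in> mspace X" "y \<in> mspace X"
  shows "mdist X x y \<le> mdiameter X"
proof -
  have "(\<lambda>(x, y). mdist X x y) (x, y) \<le> (SUP (x, y)\<in>mspace X \<times> mspace X. mdist X x y)"
    by (rule cSUP_upper[OF _ assms(1)]) (use assms in auto)
  then show ?thesis using assms by (auto simp: mdiameter_def)
qed

lemma finite_msetdist_pairs:
  assumes "finite D"
  shows "finite {msetdist X A B | A B. A \<in> D \<and> B \<in> D \<and> A \<noteq> B}"
proof -
  have "{msetdist X A B | A B. A \<in> D \<and> B \<in> D \<and> A \<noteq> B} \<subseteq> (\<lambda>(A, B). msetdist X A B) ` (D \<times> D)"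
    by auto
  then show ?thesis by (rule finite_subset) (use assms in simp)
qed

lemma partition_gap_le_mdist:
  assumes "finite D" "A \<in> D" "B \<in> D" "A \<noteq> B" "a \<in> A" "b \<in> B"
  shows "partition_gap X D \<le> mdist X a b"
proof -
  have "partition_gap X D \<le> msetdist X A B"
    unfolding partition_gap_def
    by (rule Min_le[OF finite_msetdist_pairs[OF assms(1)]]) (use assms in blast)
  also have "\<dots> \<le> mdist X a b"
    unfolding msetdist_def
  proof (rule cInf_lower)
    show "mdist X a b \<in> {mdist X a b | a b. a \<in> A \<and> b \<in> B}" using assms by blast
    show "bdd_below {mdist X a b | a b. a \<in> A \<and> b \<in> B}" by (rule bdd_belowI[of _ 0]) auto
  qed
  finally show ?thesis .
qed

lemma two_classes:
  assumes "D \<in> set_partitions X m" "2 \<le> m"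
  obtains A B where "A \<in> D" "B \<in> D" "A \<noteq> B"
proof -
  have "finite D" "\<not> card D \<le> Suc 0" using assms by (auto simp: set_partitions_def)
  then have "\<not> (\<forall>A\<in>D. \<forall>B\<in>D. A = B)" using card_le_Suc0_iff_eq[of D] by metis
  then show thesis using that by blast
qed

lemma le_partition_gap:
  assumes D: "D \<in> set_partitions X m" and m: "2 \<le> m"
    and sep: "\<And>A B a b. A \<in> D \<Longrightarrow> B \<in> D \<Longrightarrow> A \<noteq> B \<Longrightarrow> a \<in> A \<Longrightarrow> b \<in> B \<Longrightarrow> c \<le> mdist X a b"
  shows "c \<le> partition_gap X D"
proof -
  have fin: "finite D" and part: "partition_on (mspace X) D"
    using D by (auto simp: set_partitions_def)
  have "c \<le> msetdist X A B" if "A \<in> D" "B \<in> D" "A \<noteq> B" for A B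
  proof -
    have "A \<noteq> {}" "B \<noteq> {}" using part that by (auto simp: partition_on_def)
    then show ?thesis
      unfolding msetdist_def by (intro cInf_greatest) (use sep[OF that] in auto)
  qed
  moreover obtain A B where "A \<in> D" "B \<in> D" "A \<noteq> B" using two_classes[OF D m] .
  then have "{msetdist X A B | A B. A \<in> D \<and> B \<in> D \<and> A \<noteq> B} \<noteq> {}" by blast
  ultimately show ?thesis
    unfolding partition_gap_def using finite_msetdist_pairs[OF fin] by (subst Min_ge_iff) auto
qed

lemma partition_gap_le_mdiameter:
  assumes "mbounded_space X" "D \<in> set_partitions X m" "2 \<le> m"
  shows "partition_gap X D \<le> mdiameter X"
proof -
  obtain A B where AB: "A \<in> D" "B \<in> D" "A \<noteq> B" using two_classes[OF assms(2,3)] .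
  have part: "partition_on (mspace X) D" and fin: "finite D"
    using assms(2) by (auto simp: set_partitions_def)
  have "A \<noteq> {}" "B \<noteq> {}" using part AB by (auto simp: partition_on_def)
  then obtain a b where ab: "a \<in> A" "b \<in> B" by blast
  have "partition_gap X D \<le> mdist X a b"
    using partition_gap_le_mdist[OF fin AB ab] .
  also have "\<dots> \<le> mdiameter X"
    by (rule mdist_le_mdiameter[OF assms(1)]) (use partition_onD1[OF part] AB ab in blast)+
  finally show ?thesis .
qed

lemma partition_gap_le_mst_spectrum:
  assumes "mbounded_space X" "D \<in> set_partitions X (k + 1)" "1 \<le> k"
  shows "partition_gap X D \<le> mst_spectrum X k"
proof -
  have "bdd_above (partition_gap X ` set_partitions X (k + 1))"
  proof (rule bdd_aboveI2)
    show "partition_gap X D \<le> mdiameter X" if "D \<in> set_partitions X (k + 1)" for D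
      by (rule partition_gap_le_mdiameter[OF assms(1) that]) (use assms(3) in simp)
  qed
  then show ?thesis
    using assms(2) by (auto simp: mst_spectrum_def intro: cSUP_upper)
qed

lemma set_partitions_nonempty:
  assumes "finite (mspace X) \<longrightarrow> k + 1 \<le> card (mspace X)"
  shows "set_partitions X (k + 1) \<noteq> {}"
proof -
  \<comment> \<open>\<open>k\<close> points become singletons and all remaining points form the last class.\<close>
  obtain F where F: "F \<subseteq> mspace X" "finite F" "card F = k + 1"
    using assms infinite_arbitrarily_large obtain_subset_with_card_n by metis
  then obtain p where p: "p \<in> F" by fastforce
  define G where "G = F - {p}"
  have G: "G \<subseteq> mspace X" "finite G" "card G = k" "p \<in> mspace X - G"
    using F p by (auto simp: G_def)
  let ?D = "insert (mspace X - G) ((\<lambda>x. {x}) ` G)"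
  have "partition_on (mspace X) ?D"
    using G by (auto simp: partition_on_def disjoint_def)
  moreover have "card ?D = k + 1"
  proof -
    have "mspace X - G \<notin> (\<lambda>x. {x}) ` G" by auto
    then show ?thesis using G by (simp add: card_image)
  qed
  ultimately have "?D \<in> set_partitions X (k + 1)"
    using G by (simp add: set_partitions_def)
  then show ?thesis by blast
qed

section \<open>The upper bound: gluing a simplex to a partitioned space\<close>

text \<open>Here \<open>P i\<close> is the class of the vertex \<open>i\<close>, \<open>l\<close> the edge length of the simplex, and \<open>a\<close> a lower
  bound for the gap.\<close>

fun glued_dist :: "real \<Rightarrow> real \<Rightarrow> (nat \<Rightarrow> 'a set) \<Rightarrow> 'a metric \<Rightarrow> nat + 'a \<Rightarrow> nat + 'a \<Rightarrow> real" where
  "glued_dist l a P X (Inl i) (Inl j) = (if i = j then 0 else l)"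
| "glued_dist l a P X (Inl i) (Inr x) = (if x \<in> P i then (l - a) / 2 else (l + a) / 2)"
| "glued_dist l a P X (Inr x) (Inl i) = (if x \<in> P i then (l - a) / 2 else (l + a) / 2)"
| "glued_dist l a P X (Inr x) (Inr y) = mdist X x y"

text \<open>In a triangle with two points \<open>x\<close>, \<open>y\<close> of \<open>X\<close> and a vertex \<open>i\<close>, the legs at \<open>i\<close> have total length
  at least \<open>l - a\<close>, so \<open>small\<close> bounds the side \<open>x y\<close>; the legs differ by at most \<open>a\<close>, and by \<open>sep\<close> they
  differ only if the side \<open>x y\<close> has length at least \<open>a\<close>. In a triangle with two vertices, \<open>disj\<close>
  excludes that both legs have the length \<open>(l - a) / 2\<close>, so that their total length is at least \<open>l\<close>.\<close>

lemma Metric_space_glued_dist: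
  assumes a: "0 \<le> a" "a < l"
    and small: "\<And>x y. x \<in> mspace X \<Longrightarrow> y \<in> mspace X \<Longrightarrow> mdist X x y \<le> l - a"
    and disj: "\<And>i j. i < m \<Longrightarrow> j < m \<Longrightarrow> i \<noteq> j \<Longrightarrow> P i \<inter> P j = {}"
    and sep: "\<And>i x y. i < m \<Longrightarrow> x \<in> P i \<Longrightarrow> y \<in> mspace X - P i \<Longrightarrow> a \<le> mdist X x y"
  shows "Metric_space (Inl ` {..<m} \<union> Inr ` mspace X) (glued_dist l a P X)"
proof
  fix u v :: "nat + 'a"
  show "0 \<le> glued_dist l a P X u v"
    using a by (cases u; cases v) auto
  show "glued_dist l a P X u v = glued_dist l a P X v u"
    by (cases u; cases v) (auto simp: mdist_commute)
  show "glued_dist l a P X u v = 0 \<longleftrightarrow> u = v"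
    if "u \<in> Inl ` {..<m} \<union> Inr ` mspace X" "v \<in> Inl ` {..<m} \<union> Inr ` mspace X"
    using a that by (cases u; cases v) auto
next
  fix u v w :: "nat + 'a"
  assume u: "u \<in> Inl ` {..<m} \<union> Inr ` mspace X"
    and v: "v \<in> Inl ` {..<m} \<union> Inr ` mspace X"
    and w: "w \<in> Inl ` {..<m} \<union> Inr ` mspace X"
  have sep': "a \<le> mdist X y x" if "i < m" "x \<in> P i" "y \<in> mspace X - P i" for i x y
    using sep[OF that] by (simp add: mdist_commute)
  have disj': "False" if "i < m" "j < m" "i \<noteq> j" "x \<in> P i" "x \<in> P j" for i j x
    using disj[OF that(1-3)] that by blast
  show "glued_dist l a P X u w \<le> glued_dist l a P X u v + glued_dist l a P X v w"
  proof (cases u)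
    case (Inl i)
    show ?thesis
    proof (cases v)
      case v': (Inl j)
      show ?thesis using Inl v' u v w a by (cases w) (auto simp: field_simps)
    next
      case v': (Inr y)
      show ?thesis
      proof (cases w)
        case w': (Inl k)
        show ?thesis using Inl v' w' u v w a disj'[of i k y] by (auto simp: field_simps)
      next
        case w': (Inr z)
        have "0 \<le> mdist X y z" by simp
        then show ?thesis
          using Inl v' w' u v w a sep[of i y z] sep'[of i z y] by (auto simp: field_simps)
      qed
    qed
  next
    case (Inr x)
    show ?thesis
    proof (cases v)
      case v': (Inl j)
      show ?thesis
      proof (cases w)
        case w': (Inl k)
        show ?thesis using Inr v' w' u v w a disj'[of j k x] by (auto simp: field_simps)
      next
        case w': (Inr z)
        show ?thesis using Inr v' w' u v w a small[of x z] by (auto simp: field_simps)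
      qed
    next
      case v': (Inr y)
      show ?thesis
      proof (cases w)
        case w': (Inl k)
        have "0 \<le> mdist X x y" by simp
        then show ?thesis
          using Inr v' w' u v w a sep[of k x y] sep'[of k y x] by (auto simp: field_simps)
      next
        case w': (Inr z)
        show ?thesis using Inr v' w' u v w by (auto intro: mdist_triangle)
      qed
    qed
  qed
qed

lemma hausdorff_distance_le:
  assumes "0 \<le> r" "\<And>a. a \<in> A \<Longrightarrow> \<exists>b\<in>B. mdist Z a b \<le> r" "\<And>b. b \<in> B \<Longrightarrow> \<exists>a\<in>A. mdist Z a b \<le> r"
  shows "hausdorff_distance Z A B \<le> ereal r"
proof (rule ereal_le_epsilon2)
  fix e :: real assume "0 < e"
  then have "0 < r + e \<and> (\<forall>a\<in>A. \<exists>b\<in>B. mdist Z a b < r + e) \<and> (\<forall>b\<in>B. \<exists>a\<in>A. mdist Z a b < r + e)"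
    using assms by (smt (verit))
  then show "hausdorff_distance Z A B \<le> ereal r + ereal e"
    unfolding hausdorff_distance_def by (intro Inf_lower) auto
qed

lemma gromov_hausdorff_simplex_le:
  assumes bdd: "mbounded_space X" and D: "D \<in> set_partitions X m" and m: "2 \<le> m"
    and l: "mdiameter X + partition_gap X D \<le> l" "partition_gap X D < l"
  shows "gromov_hausdorff (simplex_metric l m) X \<le> ereal ((l - partition_gap X D) / 2)"
proof -
  define a where "a = partition_gap X D"
  have part: "partition_on (mspace X) D" and fin: "finite D" and card: "card D = m"
    using D by (auto simp: set_partitions_def)
  obtain P where P: "bij_betw P {..<m} D"
    using ex_bij_betw_nat_finite[OF fin] card by (auto simp: atLeast0LessThan)
  have a: "0 \<le> a" "a < l"
    using l le_partition_gap[OF D m, of 0] by (auto simp: a_def)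
  have PD: "P i \<in> D" if "i < m" for i using P that by (auto simp: bij_betw_def)
  have inj: "P i \<noteq> P j" if "i < m" "j < m" "i \<noteq> j" for i j
    using P that by (auto simp: bij_betw_def inj_on_def)
  have sub: "P i \<subseteq> mspace X" and ne: "P i \<noteq> {}" if "i < m" for i
    using part PD[OF that] by (auto simp: partition_on_def)
  have cover: "\<exists>i<m. x \<in> P i" if "x \<in> mspace X" for x
    using part that P by (auto simp: partition_on_def bij_betw_def)
  define S where "S = (Inl ` {..<m} \<union> Inr ` mspace X :: (nat + 'a) set)"
  have "Metric_space S (glued_dist l a P X)"
    unfolding S_def
  proof (rule Metric_space_glued_dist)
    show "mdist X x y \<le> l - a" if "x \<in> mspace X" "y \<in> mspace X" for x y
      using mdist_le_mdiameter[OF bdd that] l by (simp add: a_def)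
    show "P i \<inter> P j = {}" if "i < m" "j < m" "i \<noteq> j" for i j
      using part PD inj that by (auto simp: partition_on_def disjoint_def)
    show "a \<le> mdist X x y" if ixy: "i < m" "x \<in> P i" "y \<in> mspace X - P i" for i x y
    proof -
      obtain j where "j < m" "y \<in> P j" using cover[of y] ixy by blast
      then show ?thesis
        unfolding a_def using ixy PD by (intro partition_gap_le_mdist[OF fin, of "P i" "P j"]) auto
    qed
  qed (use a in auto)
  then interpret Metric_space S "glued_dist l a P X" .
  define Z where "Z = metric (S, glued_dist l a P X)"
  have Z: "mspace Z = S" "mdist Z = glued_dist l a P X"
    by (simp_all add: Z_def)
  have "0 < l" using a by simp
  then have "isometric_embedding (simplex_metric l m) Z Inl"
    by (auto simp: isometric_embedding_def Z S_def mspace_simplex_metric mdist_simplex_metric)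
  moreover have "isometric_embedding X Z Inr"
    by (auto simp: isometric_embedding_def Z S_def)
  moreover have "hausdorff_distance Z (Inl ` mspace (simplex_metric l m)) (Inr ` mspace X)
      \<le> ereal ((l - a) / 2)"
  proof (rule hausdorff_distance_le)
    fix u :: "nat + 'a" assume "u \<in> Inl ` mspace (simplex_metric l m)"
    then obtain i where i: "u = Inl i" "i < m"
      using \<open>0 < l\<close> by (auto simp: mspace_simplex_metric)
    then obtain x where "x \<in> P i" "x \<in> mspace X" using ne sub by blast
    then show "\<exists>v\<in>Inr ` mspace X. mdist Z u v \<le> (l - a) / 2"
      using i by (intro bexI[of _ "Inr x"]) (auto simp: Z)
  next
    fix v :: "nat + 'a" assume "v \<in> Inr ` mspace X"
    then obtain x where x: "v = Inr x" "x \<in> mspace X" by auto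
    then obtain i where "i < m" "x \<in> P i" using cover by blast
    then show "\<exists>u\<in>Inl ` mspace (simplex_metric l m). mdist Z u v \<le> (l - a) / 2"
      using x \<open>0 < l\<close> by (intro bexI[of _ "Inl i"]) (auto simp: Z mspace_simplex_metric)
  qed (use a in auto)
  ultimately show ?thesis
    unfolding gromov_hausdorff_def a_def[symmetric] by (intro Inf_lower2) auto
qed

section \<open>The lower bound: classes of points near the vertices\<close>

lemma mst_spectrum_nonneg:
  assumes "mbounded_space X" "1 \<le> k"
  shows "0 \<le> mst_spectrum X k"
proof (cases "set_partitions X (k + 1) = {}")
  case False
  then obtain D where D: "D \<in> set_partitions X (k + 1)" by blast
  have "0 \<le> partition_gap X D"
    by (rule le_partition_gap[OF D]) (use assms in auto)
  also have "\<dots> \<le> mst_spectrum X k"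
    by (rule partition_gap_le_mst_spectrum[OF assms(1) D assms(2)])
  finally show ?thesis .
qed (simp add: mst_spectrum_def)

text \<open>For \<open>2 r \<le> l\<close> the open \<open>r\<close>-balls around the vertices are pairwise disjoint, so they cut \<open>X\<close> into
  \<open>k + 1\<close> classes. A point close to one vertex and a point close to another one are more than
  \<open>l - 2 r\<close> apart, so this partition bounds \<open>\<sigma>\<^sub>k\<close> from below.\<close>

lemma simplex_near_imp_le:
  assumes bdd: "mbounded_space X" and k: "1 \<le> k" and l: "0 < l"
    and f: "isometric_embedding (simplex_metric l (k + 1)) Z f"
    and g: "isometric_embedding X Z g"
    and fg: "\<And>i. i < k + 1 \<Longrightarrow> \<exists>x\<in>mspace X. mdist Z (f i) (g x) < r"
    and gf: "\<And>x. x \<in> mspace X \<Longrightarrow> \<exists>i<k + 1. mdist Z (f i) (g x) < r"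
  shows "l - mst_spectrum X k \<le> 2 * r"
proof (cases "l < 2 * r")
  case True
  then show ?thesis using mst_spectrum_nonneg[OF bdd k] by simp
next
  case False
  define P where "P i = {x \<in> mspace X. mdist Z (f i) (g x) < r}" for i
  have fZ: "f i \<in> mspace Z" if "i < k + 1" for i
    using f l that by (auto simp: isometric_embedding_def mspace_simplex_metric)
  have gZ: "g x \<in> mspace Z" if "x \<in> mspace X" for x
    using g that by (auto simp: isometric_embedding_def)
  have apart: "l - 2 * r < mdist X x y"
    if ij: "i < k + 1" "j < k + 1" "i \<noteq> j" and x: "x \<in> P i" and y: "y \<in> P j" for i j x y
  proof -
    have X: "x \<in> mspace X" "y \<in> mspace X" using x y by (auto simp: P_def)
    have "l = mdist Z (f i) (f j)"
      using f l ij by (auto simp: isometric_embedding_def mspace_simplex_metric mdist_simplex_metric)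
    also have "\<dots> \<le> mdist Z (f i) (g x) + mdist Z (g x) (f j)"
      by (intro mdist_triangle fZ gZ X ij)
    also have "mdist Z (g x) (f j) \<le> mdist Z (g x) (g y) + mdist Z (g y) (f j)"
      by (intro mdist_triangle fZ gZ X ij)
    also have "mdist Z (g x) (g y) = mdist X x y"
      using g X by (auto simp: isometric_embedding_def)
    finally show ?thesis
      using x y by (simp add: P_def mdist_commute[of Z "g y"])
  qed
  have disj: "P i \<inter> P j = {}" if "i < k + 1" "j < k + 1" "i \<noteq> j" for i j
  proof (rule equals0I)
    fix x assume "x \<in> P i \<inter> P j"
    then have "l - 2 * r < mdist X x x" "x \<in> mspace X"
      using apart[OF that, of x x] by (auto simp: P_def)
    moreover from this have "mdist X x x = 0" by simp
    ultimately show False using False by linarith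
  qed
  have ne: "P i \<noteq> {}" if "i < k + 1" for i
    using fg[OF that] by (auto simp: P_def)
  define D where "D = P ` {..<k + 1}"
  have "inj_on P {..<k + 1}"
    using disj ne by (intro inj_onI) (metis inf.idem lessThan_iff)
  then have "card D = k + 1" by (simp add: D_def card_image)
  moreover have "partition_on (mspace X) D"
  proof (rule partition_onI)
    show "\<Union>D = mspace X" using gf by (fastforce simp: D_def P_def)
    show "disjnt A B" if "A \<in> D" "B \<in> D" "A \<noteq> B" for A B
      using that disj by (auto simp: D_def disjnt_def)
    show "{} \<notin> D" using ne by (auto simp: D_def)
  qed
  ultimately have D: "D \<in> set_partitions X (k + 1)"
    by (auto simp: set_partitions_def D_def)
  have "l - 2 * r \<le> partition_gap X D"
  proof (rule le_partition_gap[OF D])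
    fix A B a b assume AB: "A \<in> D" "B \<in> D" "A \<noteq> B" "a \<in> A" "b \<in> B"
    then obtain i j where "i < k + 1" "j < k + 1" "A = P i" "B = P j" by (auto simp: D_def)
    then show "l - 2 * r \<le> mdist X a b" using AB apart[of i j a b] by force
  qed (use k in simp)
  then show ?thesis using partition_gap_le_mst_spectrum[OF bdd D k] by simp
qed

lemma gromov_hausdorff_simplex_ge:
  assumes bdd: "mbounded_space X" and k: "1 \<le> k" and l: "0 < l"
  shows "ereal ((l - mst_spectrum X k) / 2) \<le> gromov_hausdorff (simplex_metric l (k + 1)) X"
  unfolding gromov_hausdorff_def
proof (rule Inf_greatest, clarify)
  fix Z :: "(nat + 'a) metric" and f g
  assume fg: "isometric_embedding (simplex_metric l (k + 1)) Z f" "isometric_embedding X Z g"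
  show "ereal ((l - mst_spectrum X k) / 2)
      \<le> hausdorff_distance Z (f ` mspace (simplex_metric l (k + 1))) (g ` mspace X)"
    unfolding hausdorff_distance_def
  proof (rule Inf_greatest, clarify)
    fix r :: real
    assume "\<forall>u\<in>f ` mspace (simplex_metric l (k + 1)). \<exists>v\<in>g ` mspace X. mdist Z u v < r"
      and "\<forall>v\<in>g ` mspace X. \<exists>u\<in>f ` mspace (simplex_metric l (k + 1)). mdist Z u v < r"
    then have "l - mst_spectrum X k \<le> 2 * r"
      using l by (intro simplex_near_imp_le[OF bdd k l fg]) (auto simp: mspace_simplex_metric)
    then show "ereal ((l - mst_spectrum X k) / 2) \<le> ereal r" by simp
  qed
qed

section \<open>The distance to a large simplex\<close>

theorem theorem4p10:
  fixes X :: "'a metric" and k :: nat and lam :: real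
  assumes "compact_space (mtopology_of X)"
    and "1 \<le> k"
    and "finite (mspace X) \<longrightarrow> k + 1 \<le> card (mspace X)"
    and "mdiameter X + mst_spectrum X k \<le> lam"
  shows "2 * gromov_hausdorff (simplex_metric lam (k + 1)) X = ereal (lam - mst_spectrum X k)"
proof -
  let ?s = "mst_spectrum X k" and ?gh = "gromov_hausdorff (simplex_metric lam (k + 1)) X"
  have bdd: "mbounded_space X" using assms(1) by (rule compact_imp_mbounded_space)
  have ne: "set_partitions X (k + 1) \<noteq> {}" using assms(3) by (rule set_partitions_nonempty)
  have "0 < mdiameter X"
  proof -
    obtain D where D: "D \<in> set_partitions X (k + 1)" using ne by blast
    obtain A B where AB: "A \<in> D" "B \<in> D" "A \<noteq> B" using two_classes[OF D] assms(2) by auto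
    have "partition_on (mspace X) D" using D by (auto simp: set_partitions_def)
    then have "A \<noteq> {}" "B \<noteq> {}" "A \<inter> B = {}" "A \<subseteq> mspace X" "B \<subseteq> mspace X"
      using AB by (auto simp: partition_on_def disjoint_def)
    then obtain a b where ab: "a \<in> mspace X" "b \<in> mspace X" "a \<noteq> b" by blast
    have "0 < mdist X a b"
      by (rule Metric_space.mdist_pos_less[OF Metric_space_mspace_mdist ab(3,1,2)])
    then show ?thesis using mdist_le_mdiameter[OF bdd ab(1,2)] by linarith
  qed
  then have s: "?s < lam" "0 < lam"
    using assms(4) mst_spectrum_nonneg[OF bdd assms(2)] by linarith+
  have "?gh \<le> ereal ((lam - ?s) / 2)"
  proof (rule ereal_le_epsilon2)
    fix e :: real assume "0 < e"
    then have "?s - 2 * e < (SUP D\<in>set_partitions X (k + 1). partition_gap X D)"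
      using ne by (simp add: mst_spectrum_def)
    then obtain D where D: "D \<in> set_partitions X (k + 1)" "?s - 2 * e < partition_gap X D"
      using less_cSUP_iff[OF ne] partition_gap_le_mst_spectrum[OF bdd _ assms(2)]
      by (metis (no_types, lifting) bdd_above.I2)
    have "partition_gap X D \<le> ?s" by (rule partition_gap_le_mst_spectrum[OF bdd D(1) assms(2)])
    then have "?gh \<le> ereal ((lam - partition_gap X D) / 2)"
      using assms(2,4) s by (intro gromov_hausdorff_simplex_le[OF bdd D(1)]) auto
    also have "\<dots> \<le> ereal ((lam - ?s) / 2) + ereal e" using D(2) by (simp add: field_simps)
    finally show "?gh \<le> ereal ((lam - ?s) / 2) + ereal e" .
  qed
  with gromov_hausdorff_simplex_ge[OF bdd assms(2) s(2)]
  have "?gh = ereal ((lam - ?s) / 2)" by (intro antisym)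
  then show ?thesis by simp
qed

end
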